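(* Let $m,r\ge 1$ and let $\mathscr{A}=\{A_1,\dots,A_r\}$ be an irreducible set of real $m\times m$ matrices. Let $e\in\mathbb{R}^m$ be a nonzero vector, $\|\cdot\|_0$ a norm on $\mathbb{R}^m$, and $\gamma(\cdot,\cdot)$ an averaging function. Let $\rho^{+}_n,\rho^{-}_n,\gamma_n$ and the norms $\|\cdot\|_n,\|\cdot\|^{\circ}_n$ be produced by the max-relaxation iteration: for $n=0,1,2,\dots$ $$\rho^{+}_{n}=\max_{x\neq0}\frac{\max_{i}\|A_{i}x\|_{n}}{\|x\|_{n}},\quad \rho^{-}_{n}=\min_{x\neq0}\frac{\max_{i}\|A_{i}x\|_{n}}{\|x\|_{n}},\quad \gamma_{n}=\gamma(\rho^{-}_{n},\rho^{+}_{n}),$$ $$\|x\|_{n+1}=\max\left\{\|x\|_{n},\ \gamma^{-1}_{n}\max_{i}\|A_{i}x\|_{n}\right\},\qquad \|x\|^{\circ}_{n+1}=\frac{\|x\|_{n+1}}{\|e\|_{n+1}}.$$ Then: (1) both sequences $\{\rho^{+}_n\}$ and $\{\rho^{-}_n\}$ converge to the joint spectral radius $\rho(\mathscr{A})$; (2) the sequence of norms $\|\cdot\|^{\circ}_n$ converges, uniformly on each bounded subset of $\mathbb{R}^m$, to some Barabanov norm $\|\cdot\|^{*}$ of $\mathscr{A}$; (3) the sequence $\{\rho^{-}_n\}$ is nondecreasing, the sequence $\{\rho^{+}_n\}$ is nonincreasing, and $\rho^{-}_n\le\rho(\mathscr{A})\le\rho^{+}_n$ for all $n=1,2,\dots$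.
   Context: A matrix set $\mathscr{A}$ is irreducible if the matrices of $\mathscr{A}$ have no common invariant subspaces except $\{0\}$ and $\mathbb{R}^m$. The joint spectral radius is $\rho(\mathscr{A})=\limsup_{n\to\infty}\left(\max_{1\le i_1,\dots,i_n\le r}\|A_{i_n}\cdots A_{i_1}\|\right)^{1/n}$, which does not depend on the choice of the norm on $\mathbb{R}^m$ (matrix norms are the induced operator norms). A Barabanov norm of $\mathscr{A}$ is a norm $\|\cdot\|$ on $\mathbb{R}^m$ such that $\rho(\mathscr{A})\|x\|=\max_{i}\|A_ix\|$ for all $x\in\mathbb{R}^m$. An averaging function is a continuous real-valued function $\gamma(t,s)$ defined for $t,s>0$ with $\gamma(t,t)=t$ and $\min\{t,s\}<\gamma(t,s)<\max\{t,s\}$ for $t\neq s$. The degenerate case $m=1$, $\mathscr{A}=\{0\}$ (where $\rho^{\pm}_n=0$ and $\gamma_n$ is undefined) is excluded. *)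

theory Defs
  imports "HOL-Analysis.Analysis"
begin

text \<open>
  A matrix set \<open>{A\<^sub>1, \<dots>, A\<^sub>r}\<close> is a family \<open>A\<close> indexed by a finite (hence nonempty) type.
\<close>

definition is_norm :: "(real ^ 'm \<Rightarrow> real) \<Rightarrow> bool" where
  "is_norm N \<longleftrightarrow>
     (\<forall>x. 0 \<le> N x) \<and> (\<forall>x. N x = 0 \<longleftrightarrow> x = 0) \<and>
     (\<forall>c x. N (c *\<^sub>R x) = \<bar>c\<bar> * N x) \<and> (\<forall>x y. N (x + y) \<le> N x + N y)"

definition irreducible_family :: "('r::finite \<Rightarrow> real ^ 'm ^ 'm) \<Rightarrow> bool" where
  "irreducible_family A \<longleftrightarrow>
     (\<forall>V. subspace V \<and> (\<forall>i. \<forall>x\<in>V. A i *v x \<in> V) \<longrightarrow> V = {0} \<or> V = UNIV)"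

text \<open>The word \<open>[i\<^sub>1, \<dots>, i\<^sub>n]\<close> yields the product \<open>A i\<^sub>n ** \<dots> ** A i\<^sub>1\<close>.\<close>

primrec word_prod :: "('r \<Rightarrow> real ^ 'm ^ 'm) \<Rightarrow> 'r list \<Rightarrow> real ^ 'm ^ 'm" where
  "word_prod A [] = mat 1"
| "word_prod A (i # w) = word_prod A w ** A i"

text \<open>
  The joint spectral radius does not depend on the norm, so the operator norm induced by the
  Euclidean norm is used. The sequence is bounded and nonnegative, so its upper limit is finite
  and \<^const>\<open>real_of_ereal\<close> loses nothing.
\<close>

definition joint_spectral_radius :: "('r::finite \<Rightarrow> real ^ 'm ^ 'm) \<Rightarrow> real" where
  "joint_spectral_radius A = real_of_ereal (limsup (\<lambda>n.
     ereal (root n (Max ((\<lambda>w. onorm ((*v) (word_prod A w))) ` {w. length w = n})))))"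

definition max_image :: "('r::finite \<Rightarrow> real ^ 'm ^ 'm) \<Rightarrow> (real ^ 'm \<Rightarrow> real) \<Rightarrow> real ^ 'm \<Rightarrow> real" where
  "max_image A N x = (MAX i. N (A i *v x))"

definition barabanov_norm :: "('r::finite \<Rightarrow> real ^ 'm ^ 'm) \<Rightarrow> (real ^ 'm \<Rightarrow> real) \<Rightarrow> bool" where
  "barabanov_norm A N \<longleftrightarrow>
     is_norm N \<and> (\<forall>x. joint_spectral_radius A * N x = max_image A N x)"

definition averaging_function :: "(real \<Rightarrow> real \<Rightarrow> real) \<Rightarrow> bool" where
  "averaging_function \<gamma> \<longleftrightarrow>
     continuous_on ({0<..} \<times> {0<..}) (\<lambda>(t, s). \<gamma> t s) \<and>
     (\<forall>t>0. \<gamma> t t = t) \<and>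
     (\<forall>t>0. \<forall>s>0. t \<noteq> s \<longrightarrow> min t s < \<gamma> t s \<and> \<gamma> t s < max t s)"

text \<open>
  Maximum and minimum over the infinite set of nonzero vectors; both are attained when \<open>N\<close> is a
  norm, because the quotient is homogeneous of degree 0 and the unit sphere is compact.
\<close>

definition rho_plus :: "('r::finite \<Rightarrow> real ^ 'm ^ 'm) \<Rightarrow> (real ^ 'm \<Rightarrow> real) \<Rightarrow> real" where
  "rho_plus A N = (GREATEST v. \<exists>x. x \<noteq> 0 \<and> v = max_image A N x / N x)"

definition rho_minus :: "('r::finite \<Rightarrow> real ^ 'm ^ 'm) \<Rightarrow> (real ^ 'm \<Rightarrow> real) \<Rightarrow> real" where
  "rho_minus A N = (LEAST v. \<exists>x. x \<noteq> 0 \<and> v = max_image A N x / N x)"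

primrec relax_norm ::
    "('r::finite \<Rightarrow> real ^ 'm ^ 'm) \<Rightarrow> (real \<Rightarrow> real \<Rightarrow> real) \<Rightarrow> (real ^ 'm \<Rightarrow> real) \<Rightarrow>
     nat \<Rightarrow> real ^ 'm \<Rightarrow> real" where
  "relax_norm A \<gamma> N0 0 = N0"
| "relax_norm A \<gamma> N0 (Suc n) =
     (let N = relax_norm A \<gamma> N0 n; \<gamma>\<^sub>n = \<gamma> (rho_minus A N) (rho_plus A N)
      in (\<lambda>x. max (N x) (inverse \<gamma>\<^sub>n * max_image A N x)))"

definition relax_norm_normalized ::
    "('r::finite \<Rightarrow> real ^ 'm ^ 'm) \<Rightarrow> (real \<Rightarrow> real \<Rightarrow> real) \<Rightarrow> (real ^ 'm \<Rightarrow> real) \<Rightarrow>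
     real ^ 'm \<Rightarrow> nat \<Rightarrow> real ^ 'm \<Rightarrow> real" where
  "relax_norm_normalized A \<gamma> N0 e n x = relax_norm A \<gamma> N0 n x / relax_norm A \<gamma> N0 n e"

end

theory Submission
  imports Defs "HOL-Complex_Analysis.Great_Picard"
begin

text \<open>
  Write \<open>M N x\<close> for the maximum of \<open>N (A i *v x)\<close> over \<open>i\<close>. The numbers \<open>rho_minus\<close> and \<open>rho_plus\<close> are the
  best constants in \<open>rho_minus * N \<le> M N \<le> rho_plus * N\<close>. Such inequalities are inherited by the next
  norm \<open>max N (M N / g)\<close>, because \<open>M\<close> is monotone, homogeneous and compatible with maxima; this gives the
  monotonicity of the two sequences. Iterated along words of matrices, they also enclose the joint
  spectral radius (\<open>joint_spectral_radius_bounds\<close>).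

  Irreducibility enters through a compactness statement (\<open>irreducible_eccentricity\<close>): all norms
  satisfying \<open>M N \<le> R * N\<close> with one \<open>R\<close> have uniformly bounded eccentricity. Suitably scaled families of
  such norms are therefore precompact (\<open>norms_precompact\<close>), and a bound at one nonzero vector is a bound
  everywhere.

  The two sequences have limits \<open>a \<le> b\<close>. If \<open>a < b\<close>, the relaxation parameters have a limit strictly
  between \<open>a\<close> and \<open>b\<close>. Vectors minimizing the quotient \<open>M N / N\<close> then keep their norm
  (\<open>slow_vector_step\<close>), so the increasing unnormalized norms are bounded and converge; but the limit
  norm would satisfy \<open>M L \<le> g * L\<close> with \<open>g < b\<close>, against the definition of \<open>b\<close>
  (\<open>bounds_same_limit\<close>). Hence both limits are the joint spectral radius.

  Consequently every limit point of the normalized norms is a Barabanov norm \<open>B\<close>. The relaxation step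
  multiplies \<open>B\<close> by a scalar, so an estimate \<open>a * B \<le> N \<le> q * a * B\<close> persists with the same ratio \<open>q\<close>
  (\<open>comparison_persists\<close>). As \<open>q\<close> can be taken arbitrarily close to 1 along the subsequence, the whole
  normalized sequence converges to \<open>B\<close>.
\<close>

section \<open>Seminorms in finite dimension\<close>

definition is_seminorm :: "('a::euclidean_space \<Rightarrow> real) \<Rightarrow> bool" where
  "is_seminorm N \<longleftrightarrow> (\<forall>c x. N (c *\<^sub>R x) = \<bar>c\<bar> * N x) \<and> (\<forall>x y. N (x + y) \<le> N x + N y)"

lemma is_seminormD:
  assumes "is_seminorm N"
  shows "N (c *\<^sub>R x) = \<bar>c\<bar> * N x" "N (x + y) \<le> N x + N y" "N 0 = 0" "0 \<le> N x"
proof -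
  show s: "N (c *\<^sub>R x) = \<bar>c\<bar> * N x" and t: "N (x + y) \<le> N x + N y" for c x y
    using assms by (auto simp: is_seminorm_def)
  show z: "N 0 = 0" using s[of 0 0] by simp
  have "N (x + (-1) *\<^sub>R x) \<le> N x + N x" using t[of x "(-1) *\<^sub>R x"] s[of "-1" x] by simp
  then show "0 \<le> N x" using z by simp
qed

lemma is_norm_iff:
  "is_norm N \<longleftrightarrow> is_seminorm N \<and> (\<forall>x. N x = 0 \<longrightarrow> x = 0)"
  using is_seminormD[of N] unfolding is_norm_def is_seminorm_def by metis

lemma is_norm_pos: "is_norm N \<Longrightarrow> x \<noteq> 0 \<Longrightarrow> 0 < N x"
  unfolding is_norm_def by (metis order_le_less)

lemma is_norm_scale:
  assumes "is_norm N" "0 < c"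
  shows "is_norm (\<lambda>x. c * N x)"
  unfolding is_norm_def
proof (intro conjI allI)
  show "c * N (x + y) \<le> c * N x + c * N y" for x y
    using mult_left_mono[of "N (x + y)" "N x + N y" c] assms by (simp add: is_norm_def distrib_left)
qed (use assms in \<open>simp_all add: is_norm_def\<close>)

text \<open>
  Up to a constant this is the maximum of a seminorm over the unit sphere. Being a finite sum, it is
  easier to pass to the limit in.
\<close>

definition basis_sum :: "('a::euclidean_space \<Rightarrow> real) \<Rightarrow> real" where
  "basis_sum N = (\<Sum>b\<in>Basis. N b)"

lemma basis_sum_nonneg: "is_seminorm N \<Longrightarrow> 0 \<le> basis_sum N"
  unfolding basis_sum_def by (intro sum_nonneg is_seminormD)

lemma seminorm_le_basis_sum:
  fixes N :: "'a::euclidean_space \<Rightarrow> real"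
  assumes "is_seminorm N"
  shows "N x \<le> basis_sum N * norm x"
proof -
  have "N (\<Sum>b\<in>B. (x \<bullet> b) *\<^sub>R b) \<le> (\<Sum>b\<in>B. N ((x \<bullet> b) *\<^sub>R b))" if "finite B" for B
    using that
  proof induction
    case empty
    then show ?case using is_seminormD[OF assms] by simp
  next
    case (insert b B)
    then show ?case using is_seminormD(2)[OF assms, of "(x \<bullet> b) *\<^sub>R b" "\<Sum>b\<in>B. (x \<bullet> b) *\<^sub>R b"]
      by simp
  qed
  from this[of Basis] have "N x \<le> (\<Sum>b\<in>Basis. N ((x \<bullet> b) *\<^sub>R b))"
    by (simp add: euclidean_representation)
  also have "\<dots> \<le> (\<Sum>b\<in>Basis. N b * norm x)"
    using is_seminormD[OF assms] Basis_le_norm[of _ x]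
    by (intro sum_mono) (simp add: mult.commute mult_left_mono)
  finally show ?thesis by (simp add: basis_sum_def sum_distrib_right)
qed

lemma seminorm_diff:
  assumes "is_seminorm N"
  shows "\<bar>N x - N y\<bar> \<le> N (x - y)"
proof -
  have "N (y - x) = N (x - y)" using is_seminormD(1)[OF assms, of "-1" "x - y"] by simp
  then show ?thesis
    using is_seminormD(2)[OF assms, of "x - y" y] is_seminormD(2)[OF assms, of "y - x" x] by simp
qed

lemma seminorm_continuous:
  assumes "is_seminorm N"
  shows "continuous_on S N"
proof -
  have "(basis_sum N)-lipschitz_on S N"
  proof (rule lipschitz_onI)
    show "dist (N x) (N y) \<le> basis_sum N * dist x y" for x y
      using seminorm_diff[OF assms, of x y] seminorm_le_basis_sum[OF assms, of "x - y"]
      by (simp add: dist_norm)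
  qed (rule basis_sum_nonneg[OF assms])
  then show ?thesis by (rule lipschitz_on_continuous_on)
qed

lemma is_norm_lower_bound:
  fixes N :: "real ^ 'm \<Rightarrow> real"
  assumes "is_norm N"
  obtains c where "0 < c" "\<And>x. c * norm x \<le> N x"
proof -
  have s: "is_seminorm N" using assms by (simp add: is_norm_iff)
  obtain u :: "real ^ 'm" where u: "u \<in> sphere 0 1" "\<And>y. y \<in> sphere 0 1 \<Longrightarrow> N u \<le> N y"
    using continuous_attains_inf[of "sphere 0 1" N] seminorm_continuous[OF s] by auto
  show ?thesis
  proof
    show "0 < N u" using u(1) is_norm_pos[OF assms, of u] by force
    show "N u * norm x \<le> N x" for x
    proof (cases "x = 0")
      case False
      have "N u \<le> N (sgn x)" using False by (intro u(2)) (simp add: norm_sgn)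
      then have "norm x * N u \<le> norm x * N (sgn x)" by (simp add: mult_left_mono)
      moreover have "N x = norm x * N (sgn x)"
        using is_seminormD(1)[OF s, of "norm x" "sgn x"] False by (simp add: sgn_div_norm)
      ultimately show ?thesis by (simp add: mult.commute)
    qed (simp add: is_seminormD[OF s])
  qed
qed

text \<open>
  The upper bound makes the norms equicontinuous, so the Arzela-Ascoli theorem applies on the unit ball,
  and homogeneity extends the limit to the whole space. The lower bound keeps the limit
  definite and allows the error to be measured relative to the limit itself.
\<close>

lemma norms_precompact:
  fixes N :: "nat \<Rightarrow> real ^ 'm \<Rightarrow> real"
  assumes "0 < c" "\<And>n. is_norm (N n)"
    and lower: "\<And>n x. c * norm x \<le> N n x" and upper: "\<And>n x. N n x \<le> C * norm x"
  obtains L k where "is_norm L" "strict_mono (k :: nat \<Rightarrow> nat)"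
    "\<And>\<epsilon>. 0 < \<epsilon> \<Longrightarrow> \<forall>\<^sub>F n in sequentially. \<forall>x. \<bar>N (k n) x - L x\<bar> \<le> \<epsilon> * L x"
    "\<And>x. (\<lambda>n. N (k n) x) \<longlonglongrightarrow> L x"
proof -
  have s: "is_seminorm (N n)" for n using assms(2) by (simp add: is_norm_iff)
  have diff: "\<bar>N n x - N n y\<bar> \<le> C * norm (x - y)" for n x y
    using seminorm_diff[OF s] upper order_trans by blast
  have "0 \<le> C * norm (axis undefined 1 :: real ^ 'm)"
    using is_seminormD(4)[OF s] upper order_trans by blast
  then have C: "0 \<le> C" by simp
  obtain g k where k: "strict_mono (k :: nat \<Rightarrow> nat)"
    and g: "\<And>e. 0 < e \<Longrightarrow> \<exists>M. \<forall>n x. n \<ge> M \<and> x \<in> cball (0 :: real ^ 'm) 1 \<longrightarrow> norm (N (k n) x - g x) < e"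
  proof (rule Arzela_Ascoli[of "cball (0 :: real ^ 'm) 1" N C])
    show "norm (N n x) \<le> C" if "x \<in> cball 0 1" for n x
      using that upper[of n x] is_seminormD(4)[OF s, of n x] mult_left_mono[OF _ C, of "norm x" 1]
      by simp
    show "\<exists>d>0. \<forall>n y. y \<in> cball 0 1 \<and> norm (x - y) < d \<longrightarrow> norm (N n x - N n y) < e"
      if "0 < e" for x e
    proof (intro exI conjI allI impI)
      show "0 < e / (C + 1)" using that C by simp
      fix n y assume "y \<in> cball 0 1 \<and> norm (x - y) < e / (C + 1)"
      then have "(C + 1) * norm (x - y) < e" using C by (simp add: field_simps)
      then show "norm (N n x - N n y) < e"
        using diff[of n x y] norm_ge_zero[of "x - y"] by (simp add: algebra_simps del: norm_ge_zero)
    qed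
  qed auto
  define L where "L x = norm x * g (sgn x)" for x
  have N_sgn: "N n x = norm x * N n (sgn x)" for n x
    using is_seminormD(1)[OF s, of n "norm x" "sgn x"]
    by (cases "x = 0") (simp_all add: sgn_div_norm is_seminormD(3)[OF s])
  have conv: "\<forall>\<^sub>F n in sequentially. \<forall>x. \<bar>N (k n) x - L x\<bar> \<le> \<epsilon> * norm x" if "0 < \<epsilon>" for \<epsilon>
  proof -
    obtain M where M: "\<And>n x. n \<ge> M \<Longrightarrow> x \<in> cball 0 1 \<Longrightarrow> norm (N (k n) x - g x) < \<epsilon>"
      using g[OF \<open>0 < \<epsilon>\<close>] by blast
    show ?thesis
      unfolding eventually_sequentially
    proof (intro exI allI impI)
      fix n x assume "M \<le> n"
      have "\<bar>N (k n) x - L x\<bar> = norm x * \<bar>N (k n) (sgn x) - g (sgn x)\<bar>"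
        using N_sgn[of "k n" x] by (simp add: L_def abs_mult flip: right_diff_distrib)
      also have "\<dots> \<le> norm x * \<epsilon>"
        using M[OF \<open>M \<le> n\<close>, of "sgn x"]
        by (intro mult_left_mono) (auto simp: norm_sgn less_imp_le split: if_splits)
      finally show "\<bar>N (k n) x - L x\<bar> \<le> \<epsilon> * norm x" by (simp add: mult.commute)
    qed
  qed
  have lim: "(\<lambda>n. N (k n) x) \<longlonglongrightarrow> L x" for x
  proof (rule tendstoI)
    fix \<epsilon> :: real assume e: "0 < \<epsilon>"
    have n: "0 < norm x + 1" using norm_ge_zero[of x] by linarith
    then have "\<epsilon> / (norm x + 1) * norm x < \<epsilon>" using e by (simp add: field_simps)
    moreover have "\<forall>\<^sub>F n in sequentially. \<bar>N (k n) x - L x\<bar> \<le> \<epsilon> / (norm x + 1) * norm x"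
      using conv[of "\<epsilon> / (norm x + 1)"] e n by (auto elim: eventually_mono)
    ultimately show "\<forall>\<^sub>F n in sequentially. dist (N (k n) x) (L x) < \<epsilon>"
      by (auto elim!: eventually_mono simp: dist_real_def)
  qed
  have Lc: "c * norm x \<le> L x" for x
    using lower by (intro LIMSEQ_le_const[OF lim]) auto
  have "is_seminorm L"
    unfolding is_seminorm_def
  proof (intro conjI allI)
    show "L (t *\<^sub>R x) = \<bar>t\<bar> * L x" for t x
      using LIMSEQ_unique[OF lim[of "t *\<^sub>R x"]] tendsto_mult_left[OF lim[of x], of "\<bar>t\<bar>"]
      by (simp add: is_seminormD(1)[OF s])
    show "L (x + y) \<le> L x + L y" for x y
      by (rule LIMSEQ_le[OF lim tendsto_add[OF lim lim]]) (simp add: is_seminormD(2)[OF s])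
  qed
  moreover have "x = 0" if "L x = 0" for x
  proof -
    have "c * norm x \<le> 0" using Lc[of x] that by simp
    then show ?thesis using \<open>0 < c\<close> by (simp add: mult_le_0_iff)
  qed
  ultimately have "is_norm L" by (simp add: is_norm_iff)
  moreover have "\<forall>\<^sub>F n in sequentially. \<forall>x. \<bar>N (k n) x - L x\<bar> \<le> \<epsilon> * L x" if "0 < \<epsilon>" for \<epsilon>
  proof -
    have "\<forall>\<^sub>F n in sequentially. \<forall>x. \<bar>N (k n) x - L x\<bar> \<le> (\<epsilon> * c) * norm x"
      using that \<open>0 < c\<close> by (intro conv) simp
    then show ?thesis
    proof (rule eventually_mono, intro allI)
      fix n x assume "\<forall>x. \<bar>N (k n) x - L x\<bar> \<le> (\<epsilon> * c) * norm x"
      then have "\<bar>N (k n) x - L x\<bar> \<le> \<epsilon> * (c * norm x)" by (simp add: mult.assoc)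
      also have "\<dots> \<le> \<epsilon> * L x" using that Lc by (intro mult_left_mono) auto
      finally show "\<bar>N (k n) x - L x\<bar> \<le> \<epsilon> * L x" .
    qed
  qed
  ultimately show ?thesis using that k lim by blast
qed

section \<open>The operator taking a norm to the maximum of its images\<close>

lemma max_image_ge: "N (A i *v x) \<le> max_image A N x"
  unfolding max_image_def by (rule Max_ge) auto

lemma max_image_attained: "\<exists>i. max_image A N x = N (A i *v x)"
proof -
  have "max_image A N x \<in> range (\<lambda>i. N (A i *v x))"
    unfolding max_image_def by (rule Max_in) auto
  then show ?thesis by blast
qed

lemma max_image_le_iff: "max_image A N x \<le> t \<longleftrightarrow> (\<forall>i. N (A i *v x) \<le> t)"
  unfolding max_image_def by (subst Max_le_iff) auto

lemma max_image_mono: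
  assumes "0 \<le> c" "\<And>y. N y \<le> c * N' y"
  shows "max_image A N x \<le> c * max_image A N' x"
proof -
  have "N (A i *v x) \<le> c * max_image A N' x" for i
    using assms(2)[of "A i *v x"] mult_left_mono[OF max_image_ge[of N' A i x] assms(1)] by linarith
  then show ?thesis by (simp add: max_image_le_iff)
qed

lemma max_image_scale:
  assumes "0 \<le> c"
  shows "max_image A (\<lambda>y. c * N y) x = c * max_image A N x"
proof (rule antisym)
  show "max_image A (\<lambda>y. c * N y) x \<le> c * max_image A N x"
    by (rule max_image_mono[OF assms]) simp
  obtain i where "max_image A N x = N (A i *v x)" using max_image_attained by blast
  then show "c * max_image A N x \<le> max_image A (\<lambda>y. c * N y) x"
    using max_image_ge[of "\<lambda>y. c * N y" A i x] by simp
qed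

lemma max_image_seminorm:
  fixes A :: "'r::finite \<Rightarrow> real ^ 'm ^ 'm"
  assumes "is_seminorm N"
  shows "is_seminorm (max_image A N)"
  unfolding is_seminorm_def
proof (intro conjI allI)
  show "max_image A N (c *\<^sub>R x) = \<bar>c\<bar> * max_image A N x" for c x
    using max_image_scale[of "\<bar>c\<bar>" A N x]
    by (simp add: max_image_def matrix_vector_mult_scaleR is_seminormD(1)[OF assms])
  show "max_image A N (x + y) \<le> max_image A N x + max_image A N y" for x y
    unfolding max_image_le_iff
    by (auto simp: matrix_vector_right_distrib
        intro!: order_trans[OF is_seminormD(2)[OF assms]] add_mono max_image_ge)
qed

lemma max_image_tendsto:
  assumes "\<And>y. (\<lambda>n. N n y) \<longlonglongrightarrow> L y"
  shows "(\<lambda>n. max_image A (N n) x) \<longlonglongrightarrow> max_image A L x"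
proof -
  have "(\<lambda>n. Max ((\<lambda>i. N n (A i *v x)) ` I)) \<longlonglongrightarrow> Max ((\<lambda>i. L (A i *v x)) ` I)"
    if "finite I" "I \<noteq> {}" for I
    using that
  proof (induction rule: finite_ne_induct)
    case (insert i I)
    then show ?case using tendsto_max[OF assms] by simp
  qed (simp add: assms)
  then show ?thesis unfolding max_image_def by simp
qed

text \<open>Homogeneity reduces the quotient to the compact unit sphere, where it attains its bounds.\<close>

lemma max_image_quotient_continuous:
  fixes A :: "'r::finite \<Rightarrow> real ^ 'm ^ 'm"
  assumes "is_norm N"
  shows "continuous_on (sphere 0 1) (\<lambda>x. max_image A N x / N x)"
proof -
  have "is_seminorm N" using assms by (simp add: is_norm_iff)
  then show ?thesis
    using assms unfolding is_norm_iff
    by (intro continuous_on_divide seminorm_continuous max_image_seminorm) force+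
qed

lemma max_image_quotient_sgn:
  fixes A :: "'r::finite \<Rightarrow> real ^ 'm ^ 'm"
  assumes "is_norm N" "x \<noteq> 0"
  shows "max_image A N (sgn x) / N (sgn x) = max_image A N x / N x"
proof -
  have s: "is_seminorm N" using assms by (simp add: is_norm_iff)
  show ?thesis
    using assms(2) by (simp add: sgn_div_norm is_seminormD(1)[OF s]
        is_seminormD(1)[OF max_image_seminorm[OF s]])
qed

lemma rho_plus:
  fixes A :: "'r::finite \<Rightarrow> real ^ 'm ^ 'm"
  assumes "is_norm N"
  shows rho_plus_attained: "\<exists>x. x \<noteq> 0 \<and> max_image A N x = rho_plus A N * N x"
    and max_image_le_rho_plus: "max_image A N x \<le> rho_plus A N * N x"
proof -
  let ?q = "\<lambda>x. max_image A N x / N x"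
  obtain u where u: "u \<in> sphere 0 1" "\<And>y. y \<in> sphere 0 1 \<Longrightarrow> ?q y \<le> ?q u"
    using continuous_attains_sup[OF _ _ max_image_quotient_continuous[OF assms, of A]] by force
  have *: "?q y \<le> ?q u" if "y \<noteq> 0" for y
    using u(2)[of "sgn y"] max_image_quotient_sgn[OF assms that, of A] that
    by (simp add: norm_sgn)
  have u0: "u \<noteq> 0" using u(1) by force
  have r: "rho_plus A N = ?q u"
    unfolding rho_plus_def by (rule Greatest_equality) (use * u0 in auto)
  show "\<exists>x. x \<noteq> 0 \<and> max_image A N x = rho_plus A N * N x"
    using u0 is_norm_pos[OF assms u0] by (intro exI[of _ u]) (simp add: r)
  have s: "is_seminorm N" using assms by (simp add: is_norm_iff)
  show "max_image A N x \<le> rho_plus A N * N x"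
  proof (cases "x = 0")
    case False
    then show ?thesis using *[OF False] is_norm_pos[OF assms False] by (simp add: r field_simps)
  qed (simp add: is_seminormD(3)[OF s] is_seminormD(3)[OF max_image_seminorm[OF s]])
qed

lemma rho_minus:
  fixes A :: "'r::finite \<Rightarrow> real ^ 'm ^ 'm"
  assumes "is_norm N"
  shows rho_minus_attained: "\<exists>x. x \<noteq> 0 \<and> max_image A N x = rho_minus A N * N x"
    and max_image_ge_rho_minus: "rho_minus A N * N x \<le> max_image A N x"
proof -
  let ?q = "\<lambda>x. max_image A N x / N x"
  obtain u where u: "u \<in> sphere 0 1" "\<And>y. y \<in> sphere 0 1 \<Longrightarrow> ?q u \<le> ?q y"
    using continuous_attains_inf[OF _ _ max_image_quotient_continuous[OF assms, of A]] by force
  have *: "?q u \<le> ?q y" if "y \<noteq> 0" for y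
    using u(2)[of "sgn y"] max_image_quotient_sgn[OF assms that, of A] that
    by (simp add: norm_sgn)
  have u0: "u \<noteq> 0" using u(1) by force
  have r: "rho_minus A N = ?q u"
    unfolding rho_minus_def by (rule Least_equality) (use * u0 in auto)
  show "\<exists>x. x \<noteq> 0 \<and> max_image A N x = rho_minus A N * N x"
    using u0 is_norm_pos[OF assms u0] by (intro exI[of _ u]) (simp add: r)
  have s: "is_seminorm N" using assms by (simp add: is_norm_iff)
  show "rho_minus A N * N x \<le> max_image A N x"
  proof (cases "x = 0")
    case False
    then show ?thesis using *[OF False] is_norm_pos[OF assms False] by (simp add: r field_simps)
  qed (simp add: is_seminormD(3)[OF s] is_seminormD(3)[OF max_image_seminorm[OF s]])
qed

lemma rho_plus_le:
  fixes A :: "'r::finite \<Rightarrow> real ^ 'm ^ 'm"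
  assumes "is_norm N" "\<And>x. max_image A N x \<le> t * N x"
  shows "rho_plus A N \<le> t"
proof -
  obtain x where "x \<noteq> 0" "max_image A N x = rho_plus A N * N x"
    using rho_plus_attained[OF assms(1)] by blast
  then show ?thesis using assms(2)[of x] is_norm_pos[OF assms(1), of x] by simp
qed

lemma rho_minus_ge:
  fixes A :: "'r::finite \<Rightarrow> real ^ 'm ^ 'm"
  assumes "is_norm N" "\<And>x. t * N x \<le> max_image A N x"
  shows "t \<le> rho_minus A N"
proof -
  obtain x where "x \<noteq> 0" "max_image A N x = rho_minus A N * N x"
    using rho_minus_attained[OF assms(1)] by blast
  then show ?thesis using assms(2)[of x] is_norm_pos[OF assms(1), of x] by simp
qed

lemma rho_minus_le_rho_plus:
  fixes A :: "'r::finite \<Rightarrow> real ^ 'm ^ 'm"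
  assumes "is_norm N"
  shows "rho_minus A N \<le> rho_plus A N"
proof -
  obtain x where x: "x \<noteq> 0" "max_image A N x = rho_minus A N * N x"
    using rho_minus_attained[OF assms(1)] by blast
  then show ?thesis using max_image_le_rho_plus[OF assms, of A x] is_norm_pos[OF assms x(1)] by simp
qed

section \<open>Irreducibility bounds the eccentricity of norms\<close>

text \<open>
  If the eccentricity were unbounded, there would be norms \<open>p n\<close> with basis sum 1 and unit vectors \<open>u n\<close>
  with \<open>p n (u n)\<close> tending to 0. Along a subsequence \<open>u n\<close> tends to some \<open>v\<close>, and the vectors on which
  \<open>p n\<close> tends to 0 form an invariant subspace that contains \<open>v\<close>. By irreducibility it is the whole
  space, so the basis sums tend to 0 as well.
\<close>

theorem irreducible_eccentricity:
  fixes A :: "'r::finite \<Rightarrow> real ^ 'm ^ 'm"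
  assumes irr: "irreducible_family A" and "0 \<le> R"
  obtains K where "0 < K"
    "\<And>N x. is_norm N \<Longrightarrow> (\<And>y. max_image A N y \<le> R * N y) \<Longrightarrow> basis_sum N * norm x \<le> K * N x"
proof (rule ccontr)
  assume contra: "\<not> thesis"
  have "\<exists>N x. is_norm N \<and> (\<forall>y. max_image A N y \<le> R * N y) \<and> real (Suc n) * N x < basis_sum N * norm x" for n
  proof (rule ccontr)
    assume "\<not> ?thesis"
    then have "thesis" by (intro that[of "real (Suc n)"]) (auto simp: not_less)
    then show False using contra by blast
  qed
  then obtain N x where N: "\<And>n. is_norm (N n)" and R: "\<And>n y. max_image A (N n) y \<le> R * N n y"
    and x: "\<And>n. real (Suc n) * N n (x n) < basis_sum (N n) * norm (x n)"
    by metis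
  have s: "is_seminorm (N n)" for n using N by (simp add: is_norm_iff)
  have pos: "0 < basis_sum (N n)" "x n \<noteq> 0" for n
  proof -
    have "0 < basis_sum (N n) * norm (x n)"
      by (rule le_less_trans[OF _ x]) (simp add: is_seminormD(4)[OF s])
    then show "0 < basis_sum (N n)" "x n \<noteq> 0"
      using basis_sum_nonneg[OF s, of n] by (auto simp: zero_less_mult_iff)
  qed
  define p where "p n y = N n y / basis_sum (N n)" for n y
  define u where "u n = sgn (x n)" for n
  have p: "is_seminorm (p n)" for n
    using s[of n] pos(1)[of n] unfolding p_def is_seminorm_def
    by (auto simp: field_simps simp flip: distrib_left intro!: mult_left_mono)
  have p_le: "p n y \<le> norm y" for n y
    using seminorm_le_basis_sum[OF s, of n y] pos(1)[of n] by (simp add: p_def field_simps)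
  have p_u: "p n (u n) \<le> inverse (real (Suc n))" for n
  proof -
    have "N n (x n) = N n (u n) * norm (x n)"
      using pos(2)[of n] by (simp add: u_def sgn_div_norm is_seminormD(1)[OF s])
    then have "real (Suc n) * N n (u n) * norm (x n) < basis_sum (N n) * norm (x n)"
      using x[of n] by (simp only: mult.assoc)
    then have "real (Suc n) * N n (u n) < basis_sum (N n)"
      by (rule mult_right_less_imp_less) simp
    then show ?thesis
      using pos(1)[of n] by (simp add: p_def field_simps)
  qed
  have "u n \<in> sphere 0 1" for n using pos(2) by (simp add: u_def norm_sgn)
  then obtain v k where v: "v \<in> sphere 0 1" and k: "strict_mono (k :: nat \<Rightarrow> nat)"
    and uv: "(u \<circ> k) \<longlonglongrightarrow> v"
    using compact_sphere[of "0 :: real ^ 'm" 1] unfolding compact_def by metis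
  define V where "V = {y. (\<lambda>n. p (k n) y) \<longlonglongrightarrow> 0}"
  have V_I: "y \<in> V" if "\<And>n. p (k n) y \<le> f n" "f \<longlonglongrightarrow> 0" for y f
  proof -
    have "(\<lambda>n. p (k n) y) \<longlonglongrightarrow> 0"
      by (rule tendsto_sandwich[OF _ _ tendsto_const that(2)])
        (simp_all add: that(1) is_seminormD(4)[OF p])
    then show ?thesis by (simp add: V_def)
  qed
  have "subspace V"
  proof (rule subspaceI)
    show "0 \<in> V" by (simp add: V_def is_seminormD(3)[OF p])
    show "a + b \<in> V" if "a \<in> V" "b \<in> V" for a b
      using that unfolding V_def
      by (intro V_I[unfolded V_def, of _ "\<lambda>n. p (k n) a + p (k n) b"] is_seminormD(2)[OF p])
        (auto intro: tendsto_add_zero)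
    show "c *\<^sub>R a \<in> V" if "a \<in> V" for c a
      using that unfolding V_def by (simp add: is_seminormD(1)[OF p] tendsto_mult_right_zero)
  qed
  moreover have "A i *v a \<in> V" if "a \<in> V" for i a
  proof (rule V_I)
    show "p (k n) (A i *v a) \<le> R * p (k n) a" for n
      using order_trans[OF max_image_ge[of "N (k n)" A i a] R[of "k n" a]] pos(1)[of "k n"]
      by (simp add: p_def divide_right_mono)
    show "(\<lambda>n. R * p (k n) a) \<longlonglongrightarrow> 0"
      using that unfolding V_def by (simp add: tendsto_mult_right_zero)
  qed
  moreover have "v \<in> V"
  proof (rule V_I)
    show "p (k n) v \<le> norm (u (k n) - v) + inverse (real (Suc (k n)))" for n
      using is_seminormD(2)[OF p, of "k n" "v - u (k n)" "u (k n)"]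
        p_le[of "k n" "v - u (k n)"] p_u[of "k n"] by (simp add: norm_minus_commute)
    have "(\<lambda>n. norm (u (k n) - v)) \<longlonglongrightarrow> 0"
      using uv by (simp add: o_def tendsto_norm_zero_iff LIM_zero_iff)
    moreover have "(\<lambda>n. inverse (real (Suc (k n)))) \<longlonglongrightarrow> 0"
      using LIMSEQ_subseq_LIMSEQ[OF LIMSEQ_inverse_real_of_nat k] by (simp add: o_def)
    ultimately show "(\<lambda>n. norm (u (k n) - v) + inverse (real (Suc (k n)))) \<longlonglongrightarrow> 0"
      by (rule tendsto_add_zero)
  qed
  moreover have "v \<noteq> 0" using v by auto
  ultimately have "V = UNIV" using irr unfolding irreducible_family_def by blast
  then have "(\<lambda>n. basis_sum (p (k n))) \<longlonglongrightarrow> 0"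
    unfolding basis_sum_def V_def by (intro tendsto_null_sum) auto
  moreover have "basis_sum (p n) = 1" for n
    using pos(1)[of n] unfolding basis_sum_def p_def by (simp flip: sum_divide_distrib)
  ultimately show False by (simp add: LIMSEQ_const_iff)
qed

text \<open>
  A nonzero vector annihilated by every matrix would span an invariant line, so the space would be
  a line on which the family vanishes.
\<close>

lemma irreducible_rho_minus_pos:
  fixes A :: "'r::finite \<Rightarrow> real ^ 'm ^ 'm"
  assumes irr: "irreducible_family A" and nz: "\<not> (CARD('m) = 1 \<and> range A = {0})" and N: "is_norm N"
  shows "0 < rho_minus A N"
proof (rule ccontr)
  assume neg: "\<not> 0 < rho_minus A N"
  obtain x where x: "x \<noteq> 0" "max_image A N x = rho_minus A N * N x"
    using rho_minus_attained[OF N] by blast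
  have ker: "A i *v x = 0" for i
  proof -
    have "N (A i *v x) \<le> 0"
      using max_image_ge[of N A i x] x(2) neg is_norm_pos[OF N x(1)]
      by (metis mult_nonpos_nonneg less_imp_le not_less order_trans)
    then show ?thesis using is_norm_pos[OF N, of "A i *v x"] by force
  qed
  have "A i *v y \<in> span {x}" if "y \<in> span {x}" for i y
    using that ker by (auto simp: span_singleton matrix_vector_mult_scaleR)
  then have "span {x} = {0} \<or> span {x} = UNIV"
    using irr subspace_span[of "{x}"] unfolding irreducible_family_def by blast
  then have U: "span {x} = UNIV" using x(1) span_base[of x "{x}"] by auto
  have "dim (UNIV :: (real ^ 'm) set) = dim {x}" by (metis U dim_span)
  then have "CARD('m) = 1" using x(1) by simp
  moreover have "A i = 0" for i
  proof -
    have "A i *v y = 0" for y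
    proof -
      have "y \<in> span {x}" using U by simp
      then show ?thesis using ker by (auto simp: span_singleton matrix_vector_mult_scaleR)
    qed
    then show ?thesis by (simp add: matrix_eq)
  qed
  ultimately show False using nz by auto
qed

section \<open>Bounds for the joint spectral radius\<close>

lemma word_prod_upper:
  fixes A :: "'r::finite \<Rightarrow> real ^ 'm ^ 'm"
  assumes "0 \<le> R" "\<And>x. max_image A N x \<le> R * N x"
  shows "N (word_prod A w *v x) \<le> R ^ length w * N x"
proof (induction w arbitrary: x)
  case (Cons i w)
  have "N (word_prod A (i # w) *v x) \<le> R ^ length w * N (A i *v x)"
    using Cons.IH[of "A i *v x"] by (simp add: matrix_vector_mul_assoc)
  also have "\<dots> \<le> R ^ length w * (R * N x)"
    using assms(1) order_trans[OF max_image_ge assms(2)] by (intro mult_left_mono) auto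
  finally show ?case by (simp add: mult_ac)
qed simp

lemma word_prod_lower:
  fixes A :: "'r::finite \<Rightarrow> real ^ 'm ^ 'm"
  assumes "0 \<le> t" "\<And>x. t * N x \<le> max_image A N x"
  shows "\<exists>w. length w = n \<and> t ^ n * N x \<le> N (word_prod A w *v x)"
proof (induction n arbitrary: x)
  case (Suc n)
  obtain i where i: "max_image A N x = N (A i *v x)" using max_image_attained by blast
  obtain w where w: "length w = n" "t ^ n * N (A i *v x) \<le> N (word_prod A w *v (A i *v x))"
    using Suc by blast
  have "t ^ Suc n * N x \<le> t ^ n * N (A i *v x)"
    using mult_left_mono[OF assms(2)[of x], of "t ^ n"] assms(1) i by (simp add: mult_ac)
  with w show ?case by (intro exI[of _ "i # w"]) (simp add: matrix_vector_mul_assoc)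
qed simp

text \<open>
  Iterating the two bounds confines the products of length \<open>n\<close> between \<open>t ^ n\<close> and \<open>R ^ n\<close> with respect
  to \<open>N\<close>. The factors \<open>c / C\<close> and \<open>C / c\<close> lost on passing to the Euclidean norm vanish under the
  \<open>n\<close>-th root.
\<close>

lemma joint_spectral_radius_bounds:
  fixes A :: "'r::finite \<Rightarrow> real ^ 'm ^ 'm"
  assumes N: "is_norm N" and "0 \<le> t"
    and lower: "\<And>x. t * N x \<le> max_image A N x" and upper: "\<And>x. max_image A N x \<le> R * N x"
  shows "t \<le> joint_spectral_radius A" "joint_spectral_radius A \<le> R"
proof -
  define m where "m n = Max ((\<lambda>w. onorm ((*v) (word_prod A w))) ` {w. length w = n})" for n
  have fin: "finite {w :: 'r list. length w = n}" for n
    using finite_lists_length_eq[of "UNIV :: 'r set" n] by simp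
  have ne: "{w :: 'r list. length w = n} \<noteq> {}" for n
    using Ex_list_of_length[of n] by auto
  have s: "is_seminorm N" using N by (simp add: is_norm_iff)
  obtain c where c: "0 < c" "\<And>x. c * norm x \<le> N x" using is_norm_lower_bound[OF N] by blast
  define C where "C = basis_sum N"
  have C: "N x \<le> C * norm x" for x unfolding C_def by (rule seminorm_le_basis_sum[OF s])
  define a :: "real ^ 'm" where "a = axis undefined 1"
  have a: "norm a = 1" by (simp add: a_def)
  have Na: "0 < N a" using is_norm_pos[OF N, of a] a by force
  then have C0: "0 < C" using C[of a] a by simp
  have "t * N a \<le> R * N a" using lower[of a] upper[of a] by simp
  then have R0: "0 \<le> R" using Na \<open>0 \<le> t\<close> by simp
  have m_upper: "m n \<le> C / c * R ^ n" for n
  proof -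
    have "onorm ((*v) (word_prod A w)) \<le> C / c * R ^ n" if "length w = n" for w
    proof (rule onorm_le)
      fix x
      have "c * norm (word_prod A w *v x) \<le> R ^ n * (C * norm x)"
        using c(2)[of "word_prod A w *v x"] word_prod_upper[OF R0 upper, of w x]
          mult_left_mono[OF C[of x], of "R ^ n"] R0 that by simp
      then show "norm (word_prod A w *v x) \<le> C / c * R ^ n * norm x"
        using c(1) by (simp add: field_simps)
    qed
    then show ?thesis unfolding m_def using fin ne by (subst Max_le_iff) auto
  qed
  have m_lower: "c / C * t ^ n \<le> m n" for n
  proof -
    obtain w where w: "length w = n" "t ^ n * N a \<le> N (word_prod A w *v a)"
      using word_prod_lower[OF \<open>0 \<le> t\<close> lower] by blast
    have "c * t ^ n \<le> t ^ n * N a"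
      using mult_left_mono[OF c(2)[of a], of "t ^ n"] \<open>0 \<le> t\<close> a by (simp add: mult.commute)
    also have "\<dots> \<le> C * norm (word_prod A w *v a)" using w(2) C order_trans by blast
    also have "\<dots> \<le> C * onorm ((*v) (word_prod A w))"
      using onorm[OF matrix_vector_mul_bounded_linear, of "word_prod A w" a] a C0 by simp
    also have "\<dots> \<le> C * m n"
      unfolding m_def using w(1) fin C0 by (intro mult_left_mono Max_ge) auto
    finally show ?thesis using C0 by (simp add: field_simps)
  qed
  have root: "(\<lambda>n. ereal (root n (q * z ^ n))) \<longlonglongrightarrow> ereal z" if "0 < q" "0 \<le> z" for q z
  proof -
    have "(\<lambda>n. root n q * z) \<longlonglongrightarrow> 1 * z"
      by (intro tendsto_mult LIMSEQ_root_const that tendsto_const)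
    moreover have "\<forall>\<^sub>F n in sequentially. root n q * z = root n (q * z ^ n)"
      using eventually_gt_at_top[of 0]
      by eventually_elim (simp add: real_root_mult real_root_power_cancel that)
    ultimately have "(\<lambda>n. root n (q * z ^ n)) \<longlonglongrightarrow> z"
      using tendsto_cong[of "\<lambda>n. root n q * z" "\<lambda>n. root n (q * z ^ n)" sequentially z] by simp
    then show ?thesis by simp
  qed
  define l where "l = limsup (\<lambda>n. ereal (root n (m n)))"
  have "ereal t = limsup (\<lambda>n. ereal (root n (c / C * t ^ n)))"
    using root[of "c / C" t] c(1) C0 \<open>0 \<le> t\<close> by (intro lim_imp_Limsup[symmetric]) auto
  also have "\<dots> \<le> l"
    unfolding l_def using eventually_gt_at_top[of 0]
    by (intro Limsup_mono, eventually_elim)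
      (simp only: ereal_less_eq, rule real_root_le_mono[OF _ m_lower])
  finally have 1: "ereal t \<le> l" .
  have "l \<le> limsup (\<lambda>n. ereal (root n (C / c * R ^ n)))"
    unfolding l_def using eventually_gt_at_top[of 0]
    by (intro Limsup_mono, eventually_elim)
      (simp only: ereal_less_eq, rule real_root_le_mono[OF _ m_upper])
  also have "\<dots> = ereal R"
    using root[of "C / c" R] c(1) C0 R0 by (intro lim_imp_Limsup) auto
  finally have 2: "l \<le> ereal R" .
  have "joint_spectral_radius A = real_of_ereal l"
    by (simp add: joint_spectral_radius_def l_def m_def)
  with 1 2 show "t \<le> joint_spectral_radius A" "joint_spectral_radius A \<le> R"
    by (cases l; simp)+
qed

section \<open>The max-relaxation iteration\<close>

locale max_relaxation =
  fixes A :: "'r::finite \<Rightarrow> real ^ 'm ^ 'm"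
    and \<gamma> :: "real \<Rightarrow> real \<Rightarrow> real"
    and N0 :: "real ^ 'm \<Rightarrow> real"
  assumes irr: "irreducible_family A"
    and nz: "\<not> (CARD('m) = 1 \<and> range A = {0})"
    and N0: "is_norm N0"
    and avg: "averaging_function \<gamma>"
begin

abbreviation "N \<equiv> relax_norm A \<gamma> N0"
abbreviation "M n \<equiv> max_image A (N n)"
abbreviation "rm n \<equiv> rho_minus A (N n)"
abbreviation "rp n \<equiv> rho_plus A (N n)"
abbreviation "g n \<equiv> \<gamma> (rm n) (rp n)"
abbreviation "\<rho> \<equiv> joint_spectral_radius A"

lemma averaging_strictly_between:
  assumes "0 < t" "t < s"
  shows "t < \<gamma> t s" "\<gamma> t s < s"
proof -
  have "\<forall>t>0. \<forall>s>0. t \<noteq> s \<longrightarrow> min t s < \<gamma> t s \<and> \<gamma> t s < max t s"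
    using avg by (simp add: averaging_function_def)
  then have "min t s < \<gamma> t s \<and> \<gamma> t s < max t s"  using assms by (metis less_irrefl less_trans)
  then show "t < \<gamma> t s" "\<gamma> t s < s" using assms by auto
qed

lemma averaging_between:
  assumes "0 < t" "t \<le> s"
  shows "t \<le> \<gamma> t s \<and> \<gamma> t s \<le> s"
proof (cases "t = s")
  case True
  then show ?thesis using avg assms by (simp add: averaging_function_def)
next
  case False
  then show ?thesis using averaging_strictly_between[of t s] assms by simp
qed

lemma relax_norm_is_norm: "is_norm (N n)"
proof (induction n)
  case (Suc n)
  have "0 < rm n" by (rule irreducible_rho_minus_pos[OF irr nz Suc])
  then have g: "0 < g n"
    using averaging_between[OF _ rho_minus_le_rho_plus[OF Suc, of A]] by force
  have s: "is_seminorm (N n)" using Suc by (simp add: is_norm_iff)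
  note sM = max_image_seminorm[OF s, of A]
  have "is_seminorm (N (Suc n))"
    unfolding is_seminorm_def
  proof (intro conjI allI)
    show "N (Suc n) (c *\<^sub>R x) = \<bar>c\<bar> * N (Suc n) x" for c x
      by (simp add: Let_def is_seminormD(1)[OF s] is_seminormD(1)[OF sM] max_mult_distrib_left
          mult.left_commute)
    show "N (Suc n) (x + y) \<le> N (Suc n) x + N (Suc n) y" for x y
    proof -
      have "inverse (g n) * M n (x + y) \<le> inverse (g n) * M n x + inverse (g n) * M n y"
        using mult_left_mono[OF is_seminormD(2)[OF sM, of x y], of "inverse (g n)"] g
        by (simp add: distrib_left)
      then show ?thesis using is_seminormD(2)[OF s, of x y] by (simp add: Let_def max_def)
    qed
  qed
  moreover have "x = 0" if "N (Suc n) x = 0" for x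
    using that is_norm_pos[OF Suc, of x] by (force simp: Let_def max_def split: if_splits)
  ultimately show ?case by (simp add: is_norm_iff)
qed (simp add: N0)

lemmas relax_norm_seminorm = relax_norm_is_norm[unfolded is_norm_iff, THEN conjunct1]

lemma le_rp: "M n x \<le> rp n * N n x"
  by (rule max_image_le_rho_plus[OF relax_norm_is_norm])

lemma ge_rm: "rm n * N n x \<le> M n x"
  by (rule max_image_ge_rho_minus[OF relax_norm_is_norm])

lemma rm_pos: "0 < rm n"
  by (rule irreducible_rho_minus_pos[OF irr nz relax_norm_is_norm])

lemma rm_le_rp: "rm n \<le> rp n"
  by (rule rho_minus_le_rho_plus[OF relax_norm_is_norm])

lemma g_between: "rm n \<le> g n" "g n \<le> rp n" "0 < g n" "0 < rp n"
proof -
  show "rm n \<le> g n" "g n \<le> rp n" using averaging_between[OF rm_pos rm_le_rp] by auto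
  then show "0 < g n" "0 < rp n" using rm_pos[of n] by linarith+
qed

lemma relax_norm_Suc: "N (Suc n) x = max (N n x) (M n x / g n)"
  by (simp add: Let_def field_simps)

declare relax_norm.simps(2) [simp del]

lemma relax_norm_mono: "n \<le> k \<Longrightarrow> N n x \<le> N k x"
  by (rule lift_Suc_mono_le[of "\<lambda>n. N n x"]) (simp_all add: relax_norm_Suc)

lemma max_image_mono_Suc: "M n x \<le> M (Suc n) x"
  using max_image_mono[of 1 "N n" "N (Suc n)" A x] relax_norm_mono[of n "Suc n"] by simp

lemma max_image_le_next: "M n x \<le> g n * N (Suc n) x"
proof -
  have "M n x / g n \<le> N (Suc n) x" by (simp add: relax_norm_Suc)
  then show ?thesis using g_between(3)[of n] by (simp add: field_simps)
qed

text \<open>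
  The next norm is the maximum of \<open>N n\<close> and a multiple of \<open>M n\<close>. The operator \<open>max_image A\<close> is monotone
  and homogeneous, so a bound \<open>M n \<le> R * N n\<close> also holds with \<open>M n\<close> in place of \<open>N n\<close>, and hence for
  the maximum. The same reason gives the lower bound.
\<close>

lemma upper_bound_step:
  assumes "0 \<le> R" "\<And>x. M n x \<le> R * N n x"
  shows "M (Suc n) x \<le> R * N (Suc n) x"
  unfolding max_image_le_iff
proof
  fix i
  have "N n (A i *v x) \<le> M n x" by (rule max_image_ge)
  also have "\<dots> \<le> R * N n x" by (rule assms)
  also have "\<dots> \<le> R * N (Suc n) x" using assms(1) relax_norm_mono[of n "Suc n"] by (simp add: mult_left_mono)
  finally have 1: "N n (A i *v x) \<le> R * N (Suc n) x" .
  have "M n (A i *v x) \<le> R * N n (A i *v x)" by (rule assms)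
  also have "\<dots> \<le> R * M n x" using assms(1) by (intro mult_left_mono max_image_ge)
  also have "\<dots> \<le> R * (g n * N (Suc n) x)" using assms(1) by (intro mult_left_mono max_image_le_next)
  finally have 2: "M n (A i *v x) / g n \<le> R * N (Suc n) x"
    using g_between(3)[of n] by (simp add: field_simps)
  show "N (Suc n) (A i *v x) \<le> R * N (Suc n) x"
    using 1 2 by (simp add: relax_norm_Suc[of n "A i *v x"])
qed

lemma lower_bound_step:
  assumes "0 \<le> t" "\<And>x. t * N n x \<le> M n x"
  shows "t * N (Suc n) x \<le> M (Suc n) x"
proof -
  obtain i where i: "M n x = N n (A i *v x)" using max_image_attained by blast
  have "t * M n x \<le> M n (A i *v x)" using assms(2)[of "A i *v x"] i by simp
  also have "\<dots> \<le> g n * N (Suc n) (A i *v x)" by (rule max_image_le_next)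
  also have "\<dots> \<le> g n * M (Suc n) x"
    using g_between(3)[of n] by (intro mult_left_mono max_image_ge) simp
  finally have "t * (M n x / g n) \<le> M (Suc n) x"
    using g_between(3)[of n] by (simp add: field_simps)
  moreover have "t * N n x \<le> M (Suc n) x" using assms(2) max_image_mono_Suc by (rule order_trans)
  ultimately show ?thesis by (simp add: relax_norm_Suc max_def)
qed

lemma decseq_rp: "decseq rp"
  by (intro decseq_SucI rho_plus_le relax_norm_is_norm upper_bound_step le_rp
      less_imp_le[OF g_between(4)])

lemma incseq_rm: "incseq rm"
  by (intro incseq_SucI rho_minus_ge relax_norm_is_norm lower_bound_step ge_rm less_imp_le[OF rm_pos])

lemma rho_between: "rm n \<le> \<rho>" "\<rho> \<le> rp n"
  using joint_spectral_radius_bounds[OF relax_norm_is_norm[of n] _ ge_rm le_rp] rm_pos[of n]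
  by simp_all

text \<open>All norms of the iteration obey the growth bound of the first one, hence share one constant.\<close>

lemma eccentricity:
  obtains K where "0 < K" "\<And>n x. basis_sum (N n) * norm x \<le> K * N n x"
proof -
  obtain K where K: "0 < K" "\<And>N x. is_norm N \<Longrightarrow> (\<And>y. max_image A N y \<le> rp 0 * N y) \<Longrightarrow>
      basis_sum N * norm x \<le> K * N x"
    using irreducible_eccentricity[OF irr, of "rp 0"] g_between(4)[of 0] by (metis less_imp_le)
  have "M n y \<le> rp 0 * N n y" for n y
  proof (induction n arbitrary: y)
    case 0
    show ?case by (rule le_rp)
  next
    case (Suc n)
    then show ?case by (rule upper_bound_step[OF less_imp_le[OF g_between(4)]])
  qed
  then show ?thesis using that K relax_norm_is_norm by blast
qed

text \<open>
  If the step has enlarged the norm of \<open>x\<close>, then \<open>g n * N (Suc n) x = M n x \<le> M (Suc n) x\<close>, so the new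
  quotient at \<open>x\<close> is at least \<open>g n\<close>. A vector whose new quotient stays below \<open>g n\<close> was therefore left
  alone by the step.
\<close>

lemma slow_vector_step:
  assumes "x \<noteq> 0" "a < g n" "0 < a" "M (Suc n) x \<le> a * N (Suc n) x"
  shows "N (Suc n) x = N n x" "M n x \<le> a * N n x"
proof -
  show *: "N (Suc n) x = N n x"
  proof (rule ccontr)
    assume "N (Suc n) x \<noteq> N n x"
    then have e: "N (Suc n) x = M n x / g n" by (auto simp: relax_norm_Suc max_def split: if_splits)
    have p: "0 < N (Suc n) x" using is_norm_pos[OF relax_norm_is_norm assms(1)] .
    have "g n * N (Suc n) x = M n x" using e g_between(3)[of n] by simp
    also have "\<dots> \<le> a * N (Suc n) x" using max_image_mono_Suc assms(4) by (rule order_trans)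
    finally show False using p assms(2) by simp
  qed
  show "M n x \<le> a * N n x" using max_image_mono_Suc[of n x] assms(4) * by simp
qed

lemma slow_vector_constant:
  assumes "x \<noteq> 0" "0 < a" "\<And>n. n0 \<le> n \<Longrightarrow> a < g n"
    "M (n0 + k) x \<le> a * N (n0 + k) x"
  shows "N (n0 + k) x = N n0 x"
  using assms(4)
proof (induction k)
  case (Suc k)
  have "a < g (n0 + k)" by (rule assms(3)) simp
  with Suc show ?case using slow_vector_step[OF assms(1) _ assms(2), of "n0 + k"] by simp
qed simp

lemma g_tendsto:
  assumes "rm \<longlonglongrightarrow> a" "rp \<longlonglongrightarrow> b" "0 < a" "0 < b"
  shows "g \<longlonglongrightarrow> \<gamma> a b"
proof -
  have "continuous_on ({0<..} \<times> {0<..}) (\<lambda>(t, s). \<gamma> t s)"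
    using avg by (simp add: averaging_function_def)
  from continuous_on_tendsto_compose[OF this tendsto_Pair[OF assms(1,2)]]
  show ?thesis using assms(3,4) rm_pos g_between(4) by simp
qed

text \<open>
  Suppose \<open>a < b\<close>. Then \<open>g n\<close> tends to some \<open>c\<close> strictly between them, by continuity and the strict
  inequalities for the averaging function. A vector minimizing the quotient of a late norm has quotient
  at most \<open>a\<close>, below all relevant \<open>g n\<close>, so the iteration has not changed its norm since a fixed index;
  by bounded eccentricity the increasing norms \<open>N n\<close> are bounded and approach a norm \<open>L\<close>. Where
  \<open>N n\<close> and \<open>N (Suc n)\<close> are both close to \<open>L\<close>, the inequality \<open>M n \<le> g n * N (Suc n)\<close> forces \<open>b \<le> c\<close>.
\<close>

theorem bounds_same_limit:
  assumes a: "rm \<longlonglongrightarrow> a" and b: "rp \<longlonglongrightarrow> b"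
  shows "a = b"
proof (rule ccontr)
  assume "a \<noteq> b"
  have rm_a: "rm n \<le> a" for n by (rule incseq_le[OF incseq_rm a])
  have b_rp: "b \<le> rp n" for n by (rule decseq_ge[OF decseq_rp b])
  have a0: "0 < a" using rm_pos[of 0] rm_a[of 0] by linarith
  have "a \<le> b" by (rule LIMSEQ_le[OF a b]) (auto intro: rm_le_rp)
  then have b0: "0 < b" and ab: "a < b" using a0 \<open>a \<noteq> b\<close> by auto
  define c where "c = \<gamma> a b"
  have c: "a < c" "c < b" and gc: "g \<longlonglongrightarrow> c"
    unfolding c_def
    by (fact averaging_strictly_between[OF a0 ab] g_tendsto[OF a b a0 b0])+
  obtain n0 where n0: "\<And>n. n0 \<le> n \<Longrightarrow> a < g n"
    using order_tendstoD(1)[OF gc c(1)] unfolding eventually_sequentially by blast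
  obtain K where K: "0 < K" "\<And>n x. basis_sum (N n) * norm x \<le> K * N n x"
    using eccentricity by blast
  obtain d where d: "0 < d" "\<And>x. d * norm x \<le> N n0 x"
    using is_norm_lower_bound[OF relax_norm_is_norm] by blast
  \<comment> \<open>A single vector of constant norm controls the whole norm.\<close>
  have bounded: "basis_sum (N (n0 + k)) \<le> K * basis_sum (N n0)" for k
  proof -
    obtain x where x: "x \<noteq> 0" "M (n0 + k) x = rm (n0 + k) * N (n0 + k) x"
      using rho_minus_attained[OF relax_norm_is_norm] by blast
    have "M (n0 + k) x \<le> a * N (n0 + k) x"
      using x(2) rm_a is_norm_pos[OF relax_norm_is_norm x(1)] by (simp add: mult_right_mono)
    then have "N (n0 + k) x = N n0 x" using slow_vector_constant[OF x(1) a0 n0] by blast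
    then have "basis_sum (N (n0 + k)) * norm x \<le> K * N n0 x"
      using K(2)[of "n0 + k" x] by simp
    also have "\<dots> \<le> K * (basis_sum (N n0) * norm x)"
      using K(1) by (intro mult_left_mono seminorm_le_basis_sum relax_norm_seminorm) simp
    finally have "basis_sum (N (n0 + k)) * norm x \<le> K * (basis_sum (N n0) * norm x)" .
    then show ?thesis using x(1) by (simp flip: mult.assoc)
  qed
  obtain L k where L: "is_norm L" and k: "strict_mono (k :: nat \<Rightarrow> nat)"
    and unif: "\<And>\<epsilon>. 0 < \<epsilon> \<Longrightarrow> \<forall>\<^sub>F j in sequentially. \<forall>x. \<bar>N (n0 + k j) x - L x\<bar> \<le> \<epsilon> * L x"
    and lim: "\<And>x. (\<lambda>j. N (n0 + k j) x) \<longlonglongrightarrow> L x"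
  proof (rule norms_precompact[OF d(1), of "\<lambda>k. N (n0 + k)" "K * basis_sum (N n0)"])
    show "d * norm x \<le> N (n0 + j) x" for j x
      using d(2) relax_norm_mono[of n0 "n0 + j" x] by (meson le_add1 order_trans)
    show "N (n0 + j) x \<le> K * basis_sum (N n0) * norm x" for j x
      using seminorm_le_basis_sum[OF relax_norm_seminorm] mult_right_mono[OF bounded]
      by (meson norm_ge_zero order_trans)
  qed (auto simp: relax_norm_is_norm)
  have le_L: "N n x \<le> L x" for n x
  proof (rule LIMSEQ_le_const[OF lim], intro exI allI impI)
    fix j assume "n \<le> j"
    also have "j \<le> n0 + k j" using seq_suble[OF k, of j] by simp
    finally show "N n x \<le> N (n0 + k j) x" by (rule relax_norm_mono)
  qed
  \<comment> \<open>Half of the relative gap between \<open>c\<close> and \<open>b\<close>, so that \<open>(1 - \<epsilon>) * b\<close> is still above \<open>c\<close>.\<close>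
  define \<epsilon> where "\<epsilon> = (1 - c / b) / 2"
  have e: "0 < \<epsilon>" "\<epsilon> < 1" "c < (1 - \<epsilon>) * b"
    using c a0 b0 by (auto simp: \<epsilon>_def field_simps)
  have "\<forall>\<^sub>F j in sequentially. (1 - \<epsilon>) * b \<le> g (n0 + k j)"
    using unif[OF e(1)]
  proof eventually_elim
    case (elim j)
    let ?n = "n0 + k j"
    obtain x where x: "x \<noteq> 0" "M ?n x = rp ?n * N ?n x"
      using rho_plus_attained[OF relax_norm_is_norm] by blast
    have L0: "0 < L x" by (rule is_norm_pos[OF L x(1)])
    have "(1 - \<epsilon>) * L x \<le> N ?n x" using elim[rule_format, of x] by (simp add: algebra_simps)
    then have "b * ((1 - \<epsilon>) * L x) \<le> rp ?n * N ?n x"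
      using b_rp[of ?n] b0 e(2) L0 by (intro mult_mono) auto
    also have "\<dots> \<le> g ?n * N (Suc ?n) x" using max_image_le_next[of ?n x] x(2) by simp
    also have "\<dots> \<le> g ?n * L x" using le_L g_between(3) by (simp add: mult_left_mono less_imp_le)
    finally have "(1 - \<epsilon>) * b * L x \<le> g ?n * L x" by (simp add: mult_ac)
    then show ?case using L0 by simp
  qed
  moreover have "(\<lambda>j. g (n0 + k j)) \<longlonglongrightarrow> c"
    using LIMSEQ_subseq_LIMSEQ[OF LIMSEQ_ignore_initial_segment[OF gc, of n0] k]
    by (simp add: o_def add.commute)
  ultimately have "(1 - \<epsilon>) * b \<le> c"
    by (intro tendsto_lowerbound) auto
  with e(3) show False by simp
qed

theorem bounds_tendsto: "rp \<longlonglongrightarrow> \<rho>" "rm \<longlonglongrightarrow> \<rho>"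
proof -
  obtain a where a: "rm \<longlonglongrightarrow> a"
    by (rule incseq_convergent[OF incseq_rm allI[OF rho_between(1)]]) blast
  obtain b where b: "rp \<longlonglongrightarrow> b"
    by (rule decseq_convergent[OF decseq_rp allI[OF rho_between(2)]]) blast
  have "a \<le> \<rho>" by (rule LIMSEQ_le_const2[OF a]) (simp add: rho_between)
  moreover have "\<rho> \<le> b" by (rule LIMSEQ_le_const[OF b]) (simp add: rho_between)
  moreover have "a = b" by (rule bounds_same_limit[OF a b])
  ultimately show "rp \<longlonglongrightarrow> \<rho>" "rm \<longlonglongrightarrow> \<rho>" using a b by auto
qed

section \<open>Convergence of the normalized norms\<close>

text \<open>
  One step of the iteration multiplies a Barabanov norm by the factor \<open>max 1 (\<rho> / g k)\<close>. Since the step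
  is monotone, both comparison constants are multiplied by this same factor, and their ratio \<open>q\<close> is
  kept. The constants themselves may drift, which is why the norms have to be normalized.
\<close>

lemma comparison_persists:
  assumes B: "barabanov_norm A B" and "0 < a"
    and ab: "\<And>x. a * B x \<le> N n x" "\<And>x. N n x \<le> q * a * B x" and "n \<le> k"
  shows "\<exists>a'>0. \<forall>x. a' * B x \<le> N k x \<and> N k x \<le> q * a' * B x"
  using \<open>n \<le> k\<close>
proof (induction k rule: dec_induct)
  case base
  then show ?case using assms by blast
next
  case (step k)
  then obtain a where a: "0 < a" "\<And>x. a * B x \<le> N k x" "\<And>x. N k x \<le> q * a * B x" by blast
  have Bn: "is_norm B" and Be: "\<And>x. max_image A B x = \<rho> * B x"
    using B by (auto simp: barabanov_norm_def)
  obtain x :: "real ^ 'm" where x: "x \<noteq> 0" using rho_plus_attained[OF Bn, of A] by blast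
  have "0 < q * a * B x" using is_norm_pos[OF relax_norm_is_norm x, of k] a(3)[of x] by linarith
  then have q: "0 \<le> q * a" using is_norm_pos[OF Bn x] by (auto simp: zero_less_mult_iff mult_nonpos_nonpos)
  let ?f = "max 1 (\<rho> / g k)"
  note g = g_between(3)[of k]
  show ?case
  proof (intro exI[of _ "a * ?f"] conjI allI)
    show "0 < a * ?f" using a(1) by (simp add: less_max_iff_disj)
    fix x
    have z: "z * ?f = max z (z * \<rho> / g k)" if "0 \<le> z" for z
      using max_mult_distrib_left[of z 1 "\<rho> / g k"] that by simp
    have f: "a * ?f * B x = max (a * B x) (a * (\<rho> * B x) / g k)"
      "q * (a * ?f) * B x = max (q * a * B x) (q * a * (\<rho> * B x) / g k)"
      using z[of "a * B x"] z[of "q * a * B x"] a(1) q Bn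
        mult_nonneg_nonneg[OF q is_seminormD(4)[of B x]]
      by (simp_all add: is_norm_iff is_seminormD(4) mult_ac)
    have "max_image A (\<lambda>y. a * B y) x \<le> 1 * M k x"
      by (rule max_image_mono) (simp_all add: a(2))
    then have "a * (\<rho> * B x) \<le> M k x"
      using max_image_scale[of a A B x] a(1) Be by simp
    then show "a * ?f * B x \<le> N (Suc k) x"
      unfolding f relax_norm_Suc using a(2) g by (intro max.mono) (simp_all add: divide_right_mono)
    have "M k x \<le> q * a * max_image A B x" by (rule max_image_mono[OF q]) (rule a(3))
    then have "M k x \<le> q * a * (\<rho> * B x)" by (simp only: Be)
    then show "N (Suc k) x \<le> q * (a * ?f) * B x"
      unfolding f relax_norm_Suc using a(3) g by (intro max.mono) (simp_all add: divide_right_mono)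
  qed
qed

text \<open>
  Normalization and bounded eccentricity place all norms between two multiples of the Euclidean norm,
  so a subsequence converges. Passing to the limit in \<open>rm n * N n \<le> M n \<le> rp n * N n\<close>, where both
  factors tend to \<open>\<rho>\<close>, shows that the limit is a Barabanov norm.
\<close>

lemma barabanov_limit_point:
  assumes e: "e \<noteq> 0"
  obtains B k where "barabanov_norm A B" "B e = 1" "strict_mono (k :: nat \<Rightarrow> nat)"
    "\<And>\<epsilon>. 0 < \<epsilon> \<Longrightarrow> \<forall>\<^sub>F j in sequentially. \<forall>x. \<bar>N (k j) x / N (k j) e - B x\<bar> \<le> \<epsilon> * B x"
proof -
  obtain K where K: "0 < K" "\<And>n x. basis_sum (N n) * norm x \<le> K * N n x"
    using eccentricity by blast
  have Ne: "0 < N n e" for n by (rule is_norm_pos[OF relax_norm_is_norm e])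
  define P where "P n x = inverse (N n e) * N n x" for n x
  have P: "is_norm (P n)" for n
    using is_norm_scale[OF relax_norm_is_norm, of "inverse (N n e)" n] Ne[of n]
    by (simp add: P_def[abs_def])
  have lower: "inverse (K * norm e) * norm x \<le> P n x" for n x
  proof -
    have "norm x * N n e \<le> norm e * (basis_sum (N n) * norm x)"
      using mult_left_mono[OF seminorm_le_basis_sum[OF relax_norm_seminorm, of n e], of "norm x"]
      by (simp add: mult_ac)
    also have "\<dots> \<le> norm e * (K * N n x)" using K(2) by (intro mult_left_mono) auto
    finally show ?thesis using Ne[of n] K(1) e by (simp add: P_def field_simps)
  qed
  have upper: "P n x \<le> K / norm e * norm x" for n x
  proof -
    have "N n x * norm e \<le> norm x * (basis_sum (N n) * norm e)"
      using mult_right_mono[OF seminorm_le_basis_sum[OF relax_norm_seminorm, of n x], of "norm e"]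
      by (simp add: mult_ac)
    also have "\<dots> \<le> norm x * (K * N n e)" using K(2) by (intro mult_left_mono) auto
    finally show ?thesis using Ne[of n] e by (simp add: P_def field_simps)
  qed
  obtain B k where B: "is_norm B" and k: "strict_mono (k :: nat \<Rightarrow> nat)"
    and unif: "\<And>\<epsilon>. 0 < \<epsilon> \<Longrightarrow> \<forall>\<^sub>F j in sequentially. \<forall>x. \<bar>P (k j) x - B x\<bar> \<le> \<epsilon> * B x"
    and lim: "\<And>x. (\<lambda>j. P (k j) x) \<longlonglongrightarrow> B x"
  proof (rule norms_precompact[of "inverse (K * norm e)" P, OF _ P lower upper])
    show "0 < inverse (K * norm e)" using K(1) e by simp
  qed blast
  have MP: "max_image A (P n) x = inverse (N n e) * M n x" for n x
    unfolding P_def using max_image_scale[of "inverse (N n e)" A "N n" x] Ne[of n] by simp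
  have ul: "rm n * P n x \<le> max_image A (P n) x" "max_image A (P n) x \<le> rp n * P n x" for n x
    using mult_left_mono[OF ge_rm[of n x], of "inverse (N n e)"]
      mult_left_mono[OF le_rp[of n x], of "inverse (N n e)"] Ne[of n]
    by (simp_all add: MP P_def mult_ac)
  have "\<rho> * B x = max_image A B x" for x
  proof (rule antisym)
    have *: "(\<lambda>j. rm (k j)) \<longlonglongrightarrow> \<rho>" "(\<lambda>j. rp (k j)) \<longlonglongrightarrow> \<rho>"
      using LIMSEQ_subseq_LIMSEQ[OF bounds_tendsto(2) k] LIMSEQ_subseq_LIMSEQ[OF bounds_tendsto(1) k]
      by (simp_all add: o_def)
    show "\<rho> * B x \<le> max_image A B x"
      by (rule LIMSEQ_le[OF tendsto_mult[OF *(1) lim] max_image_tendsto[OF lim]]) (simp add: ul)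
    show "max_image A B x \<le> \<rho> * B x"
      by (rule LIMSEQ_le[OF max_image_tendsto[OF lim] tendsto_mult[OF *(2) lim]]) (simp add: ul)
  qed
  with B have "barabanov_norm A B" by (simp add: barabanov_norm_def)
  moreover have "B e = 1"
  proof -
    have "P n e = 1" for n using Ne[of n] by (simp add: P_def)
    then show ?thesis using LIMSEQ_unique[OF lim[of e]] by simp
  qed
  ultimately show ?thesis using that k unif unfolding P_def by (simp add: divide_inverse_commute)
qed

text \<open>
  At one index of the subsequence the norm is within ratio \<open>1 + \<epsilon>\<close> of a multiple of the limit point, and
  by the preceding comparison it stays so at all later indices. This is the step from convergence of a
  subsequence to convergence of the sequence.
\<close>

theorem normalized_converges:
  assumes e: "e \<noteq> 0"
  shows "\<exists>B. barabanov_norm A B \<and>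
    (\<forall>S. bounded S \<longrightarrow> uniform_limit S (relax_norm_normalized A \<gamma> N0 e) B sequentially)"
proof -
  obtain B k where B: "barabanov_norm A B" "B e = 1" and k: "strict_mono (k :: nat \<Rightarrow> nat)"
    and unif: "\<And>\<epsilon>. 0 < \<epsilon> \<Longrightarrow> \<forall>\<^sub>F j in sequentially. \<forall>x. \<bar>N (k j) x / N (k j) e - B x\<bar> \<le> \<epsilon> * B x"
    using barabanov_limit_point[OF e] by blast
  have Bs: "is_seminorm B" using B(1) by (simp add: barabanov_norm_def is_norm_iff)
  have Ne: "0 < N n e" for n by (rule is_norm_pos[OF relax_norm_is_norm e])
  have rel: "\<forall>\<^sub>F n in sequentially. \<forall>x. \<bar>N n x / N n e - B x\<bar> \<le> \<epsilon> * B x" if "0 < \<epsilon>" for \<epsilon>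
  proof -
    \<comment> \<open>Chosen so that \<open>(1 + \<delta>) / (1 - \<delta>) = 1 + \<epsilon>\<close>.\<close>
    define \<delta> where "\<delta> = \<epsilon> / (2 + \<epsilon>)"
    have d: "0 < \<delta>" "\<delta> < 1" using that by (auto simp: \<delta>_def)
    define q where "q = 1 + \<epsilon>"
    have q: "q * (1 - \<delta>) = 1 + \<delta>" using that by (simp add: q_def \<delta>_def field_simps)
    obtain j where j: "\<And>x. \<bar>N (k j) x / N (k j) e - B x\<bar> \<le> \<delta> * B x"
      using eventually_happens[OF unif[OF d(1)]] by auto
    define a where "a = N (k j) e * (1 - \<delta>)"
    have a: "0 < a" "a * B x \<le> N (k j) x" "N (k j) x \<le> q * a * B x" for x
    proof -
      show "0 < a" using Ne d by (simp add: a_def)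
      have "(1 - \<delta>) * B x \<le> N (k j) x / N (k j) e" "N (k j) x / N (k j) e \<le> (1 + \<delta>) * B x"
        using j[of x] by (simp_all add: algebra_simps)
      then have "N (k j) e * ((1 - \<delta>) * B x) \<le> N (k j) x"
        "N (k j) x \<le> N (k j) e * ((1 + \<delta>) * B x)"
        using Ne[of "k j"] by (simp_all add: field_simps)
      moreover have "q * a * B x = N (k j) e * ((1 + \<delta>) * B x)"
        unfolding a_def q[symmetric] by (simp only: mult_ac)
      ultimately show "a * B x \<le> N (k j) x" "N (k j) x \<le> q * a * B x"
        by (simp_all only: a_def mult.assoc)
    qed
    have q0: "0 < q" "1 - \<epsilon> \<le> 1 / q" using that by (simp_all add: q_def field_simps)
    show ?thesis
      unfolding eventually_sequentially
    proof (intro exI allI impI)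
      fix n x assume "k j \<le> n"
      then obtain a' where a': "0 < a'" "\<And>x. a' * B x \<le> N n x" "\<And>x. N n x \<le> q * a' * B x"
        using comparison_persists[OF B(1) a] by blast
      have Bx: "0 \<le> B x" by (rule is_seminormD(4)[OF Bs])
      have e': "a' \<le> N n e" "N n e \<le> q * a'" using a'(2)[of e] a'(3)[of e] B(2) by simp_all
      have "N n x \<le> q * a' * B x" by (rule a')
      also have "\<dots> \<le> q * N n e * B x"
        using e' q0 Bx by (intro mult_right_mono mult_left_mono) auto
      finally have 1: "N n x / N n e \<le> q * B x" using Ne[of n] by (simp add: field_simps)
      have "N n e * B x \<le> q * a' * B x" using e' Bx by (intro mult_right_mono)
      also have "\<dots> \<le> q * N n x" using a'(2)[of x] q0 by (simp add: mult.assoc)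
      finally have "1 / q * B x \<le> N n x / N n e" using Ne[of n] q0 by (simp add: field_simps)
      moreover have "(1 - \<epsilon>) * B x \<le> 1 / q * B x" using q0(2) Bx by (rule mult_right_mono)
      ultimately show "\<bar>N n x / N n e - B x\<bar> \<le> \<epsilon> * B x"
        using 1 by (simp add: q_def algebra_simps abs_le_iff)
    qed
  qed
  have "uniform_limit S (relax_norm_normalized A \<gamma> N0 e) B sequentially" if "bounded S" for S
  proof (rule uniform_limitI)
    fix \<epsilon> :: real assume "0 < \<epsilon>"
    obtain r where r: "0 < r" "\<And>x. x \<in> S \<Longrightarrow> norm x \<le> r"
      using \<open>bounded S\<close> unfolding bounded_pos by blast
    define T where "T = basis_sum B * r + 1"
    have T: "0 < T" using basis_sum_nonneg[OF Bs] r(1) by (simp add: T_def add_nonneg_pos)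
    have BT: "B x < T" if "x \<in> S" for x
      using seminorm_le_basis_sum[OF Bs, of x] mult_left_mono[OF r(2)[OF that] basis_sum_nonneg[OF Bs]]
      by (simp add: T_def)
    have "\<forall>\<^sub>F n in sequentially. \<forall>x. \<bar>N n x / N n e - B x\<bar> \<le> \<epsilon> / T * B x"
      using \<open>0 < \<epsilon>\<close> T by (intro rel) simp
    then show "\<forall>\<^sub>F n in sequentially. \<forall>x\<in>S. dist (relax_norm_normalized A \<gamma> N0 e n x) (B x) < \<epsilon>"
    proof (eventually_elim, intro ballI)
      fix n x assume *: "\<forall>x. \<bar>N n x / N n e - B x\<bar> \<le> \<epsilon> / T * B x" and "x \<in> S"
      have "\<epsilon> / T * B x < \<epsilon>" using BT[OF \<open>x \<in> S\<close>] T \<open>0 < \<epsilon>\<close> by (simp add: field_simps)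
      with * show "dist (relax_norm_normalized A \<gamma> N0 e n x) (B x) < \<epsilon>"
        unfolding relax_norm_normalized_def dist_real_def by (meson le_less_trans)
    qed
  qed
  with B(1) show ?thesis by blast
qed

end

theorem mainTheorem1:
  fixes A :: "'r::finite \<Rightarrow> real ^ 'm ^ 'm"
    and e :: "real ^ 'm"
    and N0 :: "real ^ 'm \<Rightarrow> real"
    and \<gamma> :: "real \<Rightarrow> real \<Rightarrow> real"
  assumes "irreducible_family A"
    and "\<not> (CARD('m) = 1 \<and> range A = {0})"
    and "e \<noteq> 0"
    and "is_norm N0"
    and "averaging_function \<gamma>"
  shows "(\<lambda>n. rho_plus A (relax_norm A \<gamma> N0 n)) \<longlonglongrightarrow> joint_spectral_radius A \<and>
         (\<lambda>n. rho_minus A (relax_norm A \<gamma> N0 n)) \<longlonglongrightarrow> joint_spectral_radius A \<and>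
         (\<exists>N'. barabanov_norm A N' \<and>
            (\<forall>S. bounded S \<longrightarrow>
               uniform_limit S (relax_norm_normalized A \<gamma> N0 e) N' sequentially)) \<and>
         incseq (\<lambda>n. rho_minus A (relax_norm A \<gamma> N0 n)) \<and>
         decseq (\<lambda>n. rho_plus A (relax_norm A \<gamma> N0 n)) \<and>
         (\<forall>n\<ge>1. rho_minus A (relax_norm A \<gamma> N0 n) \<le> joint_spectral_radius A \<and>
                joint_spectral_radius A \<le> rho_plus A (relax_norm A \<gamma> N0 n))"
proof -
  interpret max_relaxation A \<gamma> N0 by standard (fact assms)+
  show ?thesis
    using bounds_tendsto normalized_converges[OF assms(3)] incseq_rm decseq_rp rho_between
    by blast
qed

end
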